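(* There exist a finite set $\Omega$ and a strongly regular partition of $\mathcal{P}(\Omega)$ that is not the set of orbits on $\mathcal{P}(\Omega)$ of any group of permutations of $\Omega$.
   Context: $\mathcal{P}(\Omega)$ is the powerset of $\Omega$; a group of permutations of $\Omega$ acts on $\mathcal{P}(\Omega)$ by $\sigma\cdot A=\{\sigma(a):a\in A\}$. A strongly regular partition of $\mathcal{P}(\Omega)$ is a partition of $\mathcal{P}(\Omega)$ into (nonempty) blocs $\mathsf{B}_1,\ldots,\mathsf{B}_s$ such that: (1) all sets in a given bloc have the same size; (2) for any bloc $\mathsf{B}_i$, the set of all complements (in $\Omega$) of the members of $\mathsf{B}_i$ is also a bloc; (3) for any two blocs $\mathsf{B}_i$ and $\mathsf{B}_j$, the number of members of $\mathsf{B}_j$ that are included in a member $A$ of $\mathsf{B}_i$ is independent of the choice of $A$ in $\mathsf{B}_i$. *)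

theory Defs
  imports "HOL-Library.Disjoint_Sets" "HOL-Algebra.Bij" "HOL-Algebra.Group_Action"
begin

definition strongly_regular_partition :: "'a set \<Rightarrow> 'a set set set \<Rightarrow> bool" where
  "strongly_regular_partition \<Omega> P \<longleftrightarrow>
     partition_on (Pow \<Omega>) P \<and>
     (\<forall>B\<in>P. \<forall>A\<in>B. \<forall>A'\<in>B. card A = card A') \<and>
     (\<forall>B\<in>P. (\<lambda>A. \<Omega> - A) ` B \<in> P) \<and>
     (\<forall>B\<in>P. \<forall>B'\<in>P. \<forall>A\<in>B. \<forall>A'\<in>B.
        card {C \<in> B'. C \<subseteq> A} = card {C \<in> B'. C \<subseteq> A'})"

(* BijGroup represents permutations of \<Omega> as bijections that are undefined outside
   \<Omega>; this is harmless below, since only images of subsets of \<Omega> are taken. *)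
definition powerset_orbits :: "'a set \<Rightarrow> ('a \<Rightarrow> 'a) set \<Rightarrow> 'a set set set" where
  "powerset_orbits \<Omega> G =
     orbits ((BijGroup \<Omega>)\<lparr>carrier := G\<rparr>) (Pow \<Omega>) (\<lambda>\<sigma> A. \<sigma> ` A)"

end

theory Submission
  imports Defs
begin

text \<open>The counterexample lives on the corners of two squares, \<open>0, 1, 2, 3\<close> and \<open>4, 5, 6, 7\<close>, each in
  cyclic order. A subset of one square carries two signs. Its bias \<open>d\<close> counts the chosen corners on
  one diagonal minus those on the other. Its side sign \<open>x\<close> is \<open>1\<close> or \<open>-1\<close> when the subset is a side
  of the square, according to the direction of that side, and \<open>0\<close> otherwise. The two signs have
  disjoint supports: a side has bias \<open>0\<close>, and every other subset has side sign \<open>0\<close>.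

  Subsets \<open>A\<close> of the eight points are put into one bloc when they have the same sizes and absolute
  biases in both squares and the same products \<open>x\<^sub>1 d\<^sub>2\<close>, \<open>d\<^sub>1 x\<^sub>2\<close> and \<open>x\<^sub>1 x\<^sub>2\<close>. The product \<open>d\<^sub>1 d\<^sub>2\<close> is
  deliberately left out. A permutation that fixes all blocs and both squares multiplies \<open>d\<^sub>1, x\<^sub>1, d\<^sub>2, x\<^sub>2\<close>
  by signs; preserving the three recorded products forces these signs to agree, so that
  \<open>d\<^sub>1 d\<^sub>2\<close> is preserved as well. Hence the bloc of the sets with one point in each square, on which \<open>d\<^sub>1 d\<^sub>2\<close>
  takes both values, cannot be a single orbit.

  Counting inclusions, on the other hand, does not detect \<open>d\<^sub>1 d\<^sub>2\<close>. The number of subsets of \<open>A\<close> in each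
  bloc is unchanged when the signs of both squares are reversed at once. If neither part of \<open>A\<close> is
  a side, it is also unchanged when only \<open>d\<^sub>1\<close> is reversed. This reversal affects only those subsets
  of \<open>A\<close> whose first part has nonzero bias and whose second part is a side. Now a set that is not a
  side contains equally many sides of both directions, so exchanging the directions in the second
  square, for these first parts, undoes the effect on \<open>d\<^sub>1 x\<^sub>2\<close>; and since the signs have disjoint
  supports, it leaves the other two products at \<open>0\<close> (lemma \<open>lower_sum_reverse1\<close>). These two moves
  connect any two sets of the same bloc (lemma \<open>lower_sum_cong\<close>).\<close>

section \<open>Subsets of one square\<close>

type_synonym signature = "int \<times> int \<times> int"

definition square :: "nat \<Rightarrow> nat set" where
  "square q = {q, q + 1, q + 2, q + 3}"

definition corner :: "nat set \<Rightarrow> nat \<Rightarrow> int" where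
  "corner A i = of_bool (i \<in> A)"

text \<open>Size, bias and side sign. The product in the last component vanishes as soon as a diagonal is
  disjoint from the set or contained in it, so it is nonzero exactly for the four sides.\<close>

definition signature :: "nat \<Rightarrow> nat set \<Rightarrow> signature" where
  "signature q A =
     (corner A q + corner A (q + 1) + corner A (q + 2) + corner A (q + 3),
      corner A q - corner A (q + 1) + corner A (q + 2) - corner A (q + 3),
      (corner A q - corner A (q + 2)) * (corner A (q + 1) - corner A (q + 3)))"

definition signatures :: "signature set" where
  "signatures = {(0,0,0), (1,1,0), (1,-1,0), (2,2,0), (2,-2,0), (2,0,1), (2,0,-1),
     (3,1,0), (3,-1,0), (4,0,0)}"

text \<open>The signatures of all subsets of a set with the given signature, with multiplicity. That they
  are determined by the signature is the regularity of a single square.\<close>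

fun lower :: "signature \<Rightarrow> signature list" where
  "lower (s, d, x) =
    (if s = 0 then [(0,0,0)]
     else if s = 1 then [(0,0,0), (1,d,0)]
     else if s = 2 \<and> x \<noteq> 0 then [(0,0,0), (1,1,0), (1,-1,0), (2,0,x)]
     else if s = 2 then [(0,0,0), (1,d div 2,0), (1,d div 2,0), (2,d,0)]
     else if s = 3 then
       [(0,0,0), (1,d,0), (1,d,0), (1,-d,0), (2,2*d,0), (2,0,1), (2,0,-1), (3,d,0)]
     else
       [(0,0,0), (1,1,0), (1,1,0), (1,-1,0), (1,-1,0),
        (2,2,0), (2,-2,0), (2,0,1), (2,0,1), (2,0,-1), (2,0,-1),
        (3,1,0), (3,1,0), (3,-1,0), (3,-1,0), (4,0,0)])"

lemma sum_Pow_insert: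
  assumes "finite B" "a \<notin> B"
  shows "(\<Sum>C\<in>Pow (insert a B). f C) = (\<Sum>C\<in>Pow B. f C) + (\<Sum>C\<in>Pow B. f (insert a C))"
proof -
  have "inj_on (insert a) (Pow B)"
    using assms(2) by (intro inj_onI) (metis PowD insert_ident subsetD)
  moreover have "Pow B \<inter> insert a ` Pow B = {}"
    using assms(2) by auto
  ultimately show ?thesis
    using assms(1) by (simp add: Pow_insert sum.union_disjoint sum.reindex)
qed

lemma signature_in_signatures: "signature q A \<in> signatures"
  by (cases "q \<in> A"; cases "q + 1 \<in> A"; cases "q + 2 \<in> A"; cases "q + 3 \<in> A")
    (simp_all add: signature_def signatures_def corner_def)

lemma signature_Int_square: "signature q (A \<inter> square q) = signature q A"
  by (simp add: signature_def corner_def square_def)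

lemma sum_Pow_square:
  fixes h :: "signature \<Rightarrow> nat"
  shows "(\<Sum>C\<in>Pow (A \<inter> square q). h (signature q C)) =
         (\<Sum>l\<leftarrow>lower (signature q A). h l)"
proof -
  have A: "A \<inter> square q = (if q \<in> A then {q} else {}) \<union> (if q + 1 \<in> A then {q + 1} else {}) \<union>
      (if q + 2 \<in> A then {q + 2} else {}) \<union> (if q + 3 \<in> A then {q + 3} else {})"
    by (cases "q \<in> A"; cases "q + 1 \<in> A"; cases "q + 2 \<in> A"; cases "q + 3 \<in> A")
      (simp_all add: square_def insert_commute)
  show ?thesis
    unfolding A
    by (cases "q \<in> A"; cases "q + 1 \<in> A"; cases "q + 2 \<in> A"; cases "q + 3 \<in> A")
      (simp_all add: sum_Pow_insert, simp_all add: signature_def corner_def)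
qed

text \<open>Reversing both signs corresponds to turning the square by a right angle, and keeping the bias
  while exchanging the directions of the sides corresponds to a reflection in a diagonal.\<close>

fun turn :: "signature \<Rightarrow> signature" where
  "turn (s, d, x) = (s, -d, -x)"

fun flip_side :: "signature \<Rightarrow> signature" where
  "flip_side (s, d, x) = (s, d, -x)"

lemma turn_turn [simp]: "turn (turn l) = l"
  by (cases l) simp

lemma turn_in_signatures:
  assumes "l \<in> signatures"
  shows "turn l \<in> signatures"
  using assms by (auto simp: signatures_def)

lemma lower_turn:
  fixes h :: "signature \<Rightarrow> nat"
  assumes "l \<in> signatures"
  shows "(\<Sum>c\<leftarrow>lower (turn l). h c) = (\<Sum>c\<leftarrow>lower l. h (turn c))"
  using assms by (auto simp: signatures_def)

text \<open>A set that is not a side contains equally many sides of both directions.\<close>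

lemma lower_flip_side:
  fixes h :: "signature \<Rightarrow> nat"
  assumes "(s, d, 0) \<in> signatures"
  shows "(\<Sum>c\<leftarrow>lower (s, d, 0). h (flip_side c)) = (\<Sum>c\<leftarrow>lower (s, d, 0). h c)"
  using assms by (auto simp: signatures_def)

lemma lower_subset_signatures:
  assumes "l \<in> signatures"
  shows "set (lower l) \<subseteq> signatures"
  using assms unfolding signatures_def by (elim insertE emptyE; simp)

lemma signatures_same_size_bias:
  assumes "(s, d, x) \<in> signatures" "(s, d', x') \<in> signatures" "\<bar>d\<bar> = \<bar>d'\<bar>"
  shows "(s, d', x') = (s, d, x) \<or> (s, d', x') = turn (s, d, x)"
  using assms by (auto simp: signatures_def)

lemma bias_or_side_zero:
  assumes "(s, d, x) \<in> signatures"
  shows "d = 0 \<or> x = 0"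
  using assms by (auto simp: signatures_def)

declare lower.simps [simp del]

section \<open>The partition on two squares\<close>

type_synonym colour = "int \<times> int \<times> int \<times> int \<times> int \<times> int \<times> int"

fun blend :: "signature \<Rightarrow> signature \<Rightarrow> colour" where
  "blend (s1, d1, x1) (s2, d2, x2) =
     (s1, \<bar>d1\<bar>, s2, \<bar>d2\<bar>, x1 * d2, d1 * x2, x1 * x2)"

definition points :: "nat set" where
  "points = square 0 \<union> square 4"

definition colour :: "nat set \<Rightarrow> colour" where
  "colour A = blend (signature 0 A) (signature 4 A)"

definition bloc :: "colour \<Rightarrow> nat set set" where
  "bloc k = {A \<in> Pow points. colour A = k}"

definition blocs :: "nat set set set" where
  "blocs = bloc ` colour ` Pow points"

definition lower_sum :: "(colour \<Rightarrow> nat) \<Rightarrow> signature \<Rightarrow> signature \<Rightarrow> nat" where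
  "lower_sum h l1 l2 = (\<Sum>c1\<leftarrow>lower l1. \<Sum>c2\<leftarrow>lower l2. h (blend c1 c2))"

lemma mem_bloc: "C \<in> bloc k \<longleftrightarrow> C \<subseteq> points \<and> colour C = k"
  by (simp add: bloc_def)

lemma finite_points [simp]: "finite points"
  by (simp add: points_def square_def)

lemma sum_Pow_Un_disjoint:
  assumes "X \<inter> Y = {}"
  shows "(\<Sum>C\<in>Pow (X \<union> Y). f (C \<inter> X) (C \<inter> Y)) = (\<Sum>C1\<in>Pow X. \<Sum>C2\<in>Pow Y. f C1 C2)"
proof -
  have "(\<Sum>C\<in>Pow (X \<union> Y). f (C \<inter> X) (C \<inter> Y)) = (\<Sum>p\<in>Pow X \<times> Pow Y. f (fst p) (snd p))"
  proof (rule sum.reindex_bij_witness[where i = "\<lambda>p. fst p \<union> snd p"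
        and j = "\<lambda>C. (C \<inter> X, C \<inter> Y)"])
    fix p assume "p \<in> Pow X \<times> Pow Y"
    then have "fst p \<subseteq> X" "snd p \<subseteq> Y" by auto
    then have "(fst p \<union> snd p) \<inter> X = fst p" "(fst p \<union> snd p) \<inter> Y = snd p"
      using assms by blast+
    then show "((fst p \<union> snd p) \<inter> X, (fst p \<union> snd p) \<inter> Y) = p"
      by simp
  qed auto
  then show ?thesis
    by (simp add: sum.cartesian_product case_prod_beta)
qed

lemma sum_Pow_colour:
  assumes "A \<subseteq> points"
  shows "(\<Sum>C\<in>Pow A. h (colour C)) = lower_sum h (signature 0 A) (signature 4 A)"
proof -
  let ?X = "A \<inter> square 0" and ?Y = "A \<inter> square 4"
  have "?X \<inter> ?Y = {}"
    by (auto simp: square_def)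
  have "?X \<union> ?Y = A"
    using assms by (auto simp only: points_def)
  have "colour C = blend (signature 0 (C \<inter> ?X)) (signature 4 (C \<inter> ?Y))" if "C \<in> Pow A" for C
  proof -
    have "C \<inter> ?X = C \<inter> square 0" "C \<inter> ?Y = C \<inter> square 4"
      using that by blast+
    then show ?thesis
      by (simp only: colour_def signature_Int_square)
  qed
  then have "(\<Sum>C\<in>Pow A. h (colour C)) =
      (\<Sum>C\<in>Pow (?X \<union> ?Y). h (blend (signature 0 (C \<inter> ?X)) (signature 4 (C \<inter> ?Y))))"
    unfolding \<open>?X \<union> ?Y = A\<close> by (intro sum.cong refl) simp
  also have "\<dots> = (\<Sum>C1\<in>Pow ?X. \<Sum>C2\<in>Pow ?Y. h (blend (signature 0 C1) (signature 4 C2)))"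
    by (rule sum_Pow_Un_disjoint[OF \<open>?X \<inter> ?Y = {}\<close>,
          where f = "\<lambda>C1 C2. h (blend (signature 0 C1) (signature 4 C2))"])
  also have "\<dots> = (\<Sum>C1\<in>Pow ?X. \<Sum>c2\<leftarrow>lower (signature 4 A). h (blend (signature 0 C1) c2))"
    using sum_Pow_square[where A = A and q = 4 and h = "\<lambda>l. h (blend (signature 0 C1) l)" for C1]
    by (intro sum.cong refl)
  also have "\<dots> = lower_sum h (signature 0 A) (signature 4 A)"
    unfolding lower_sum_def
    by (rule sum_Pow_square[where h = "\<lambda>l. \<Sum>c2\<leftarrow>lower (signature 4 A). h (blend l c2)"])
  finally show ?thesis .
qed

lemma blend_turn: "blend (turn l1) (turn l2) = blend l1 l2"
  by (cases l1; cases l2) simp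

lemma lower_sum_turn:
  assumes "l1 \<in> signatures" "l2 \<in> signatures"
  shows "lower_sum h (turn l1) (turn l2) = lower_sum h l1 l2"
  unfolding lower_sum_def
  using assms by (simp only: lower_turn blend_turn)

text \<open>Reversing the bias of a part \<open>c1\<close> alone amounts to a turn followed by an exchange of side
  directions, and the exchange is harmless by \<open>lower_flip_side\<close> in the first square. The reversal
  matters only if \<open>c1\<close> has nonzero bias, through the product with the side sign of \<open>c2\<close>. It is then
  compensated by exchanging the side directions of \<open>c2\<close> for this \<open>c1\<close>; as \<open>c1\<close> is not a side, the product
  of the two side signs stays \<open>0\<close>.\<close>

lemma lower_sum_reverse1:
  assumes "(s1, d1, 0) \<in> signatures" "(s2, d2, 0) \<in> signatures"
  shows "lower_sum h (s1, -d1, 0) (s2, d2, 0) = lower_sum h (s1, d1, 0) (s2, d2, 0)"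
proof -
  let ?l1 = "(s1, d1, 0) :: signature" and ?l2 = "(s2, d2, 0) :: signature"
  have "lower_sum h (s1, -d1, 0) ?l2 =
      (\<Sum>c1\<leftarrow>lower ?l1. \<Sum>c2\<leftarrow>lower ?l2. h (blend (turn c1) c2))"
    using lower_turn[OF assms(1), where h = "\<lambda>c1. \<Sum>c2\<leftarrow>lower ?l2. h (blend c1 c2)"]
    by (simp only: lower_sum_def turn.simps minus_zero)
  also have "\<dots> = (\<Sum>c1\<leftarrow>lower ?l1. \<Sum>c2\<leftarrow>lower ?l2. h (blend (turn (flip_side c1)) c2))"
    by (rule lower_flip_side[OF assms(1), symmetric])
  also have "\<dots> = (\<Sum>c1\<leftarrow>lower ?l1. \<Sum>c2\<leftarrow>lower ?l2. h (blend c1 c2))"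
  proof (rule arg_cong[where f = sum_list], rule map_cong[OF refl])
    fix c1 assume "c1 \<in> set (lower ?l1)"
    then have "c1 \<in> signatures"
      using lower_subset_signatures[OF assms(1)] by blast
    obtain s d x where c1: "c1 = (s, d, x)"
      by (cases c1)
    consider "d = 0" | "x = 0"
      using bias_or_side_zero \<open>c1 \<in> signatures\<close> c1 by blast
    then show "(\<Sum>c2\<leftarrow>lower ?l2. h (blend (turn (flip_side c1)) c2)) =
        (\<Sum>c2\<leftarrow>lower ?l2. h (blend c1 c2))"
    proof cases
      case 1
      then show ?thesis by (simp only: c1 turn.simps flip_side.simps minus_zero minus_minus)
    next
      case 2
      have "blend (turn (flip_side c1)) (flip_side c2) = blend c1 c2" for c2
        using 2 by (cases c2) (simp add: c1)
      then show ?thesis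
        using lower_flip_side[OF assms(2), where h = "\<lambda>c2. h (blend (turn (flip_side c1)) c2)"]
        by simp
    qed
  qed
  finally show ?thesis
    by (simp only: lower_sum_def)
qed

lemma lower_sum_cong:
  assumes "l1 \<in> signatures" "l2 \<in> signatures" "m1 \<in> signatures" "m2 \<in> signatures"
    and eq: "blend l1 l2 = blend m1 m2"
  shows "lower_sum h l1 l2 = lower_sum h m1 m2"
proof -
  obtain s1 d1 x1 where l1: "l1 = (s1, d1, x1)" by (cases l1)
  obtain s2 d2 x2 where l2: "l2 = (s2, d2, x2)" by (cases l2)
  (* If turning the first part alone keeps the colour, then all three products vanish, which
     leaves three possibilities: turning the second part has no effect, turning the first part
     has no effect, or neither part is a side. *)
  have half: "lower_sum h (turn l1) l2 = lower_sum h l1 l2" if "blend (turn l1) l2 = blend l1 l2"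
  proof -
    have zero: "x1 * d2 = 0" "d1 * x2 = 0" "x1 * x2 = 0"
      using that by (simp_all add: l1 l2)
    consider "x1 \<noteq> 0" | "d1 = 0" "x1 = 0" | "d1 \<noteq> 0" "x1 = 0"
      by blast
    then show ?thesis
    proof cases
      case 1
      then have "turn l2 = l2"
        using zero by (simp add: l2)
      then show ?thesis
        using lower_sum_turn[OF assms(1,2)] by simp
    next
      case 2
      then show ?thesis by (simp add: l1)
    next
      case 3
      then have "x2 = 0"
        using zero by simp
      then show ?thesis
        using lower_sum_reverse1 assms(1,2) 3 by (simp add: l1 l2)
    qed
  qed
  have other: "lower_sum h l1 (turn l2) = lower_sum h (turn l1) l2"
      "blend l1 (turn l2) = blend (turn l1) l2"
    using lower_sum_turn[OF turn_in_signatures[OF assms(1)] assms(2), of h] blend_turn[of "turn l1" l2]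
    by simp_all
  obtain t1 e1 y1 where m1: "m1 = (t1, e1, y1)" by (cases m1)
  obtain t2 e2 y2 where m2: "m2 = (t2, e2, y2)" by (cases m2)
  have "t1 = s1" "\<bar>d1\<bar> = \<bar>e1\<bar>" "t2 = s2" "\<bar>d2\<bar> = \<bar>e2\<bar>"
    using eq by (simp_all add: l1 l2 m1 m2)
  then have "m1 = l1 \<or> m1 = turn l1" "m2 = l2 \<or> m2 = turn l2"
    using signatures_same_size_bias assms(1-4) by (simp_all only: l1 l2 m1 m2)
  then consider "m1 = l1" "m2 = l2" | "m1 = turn l1" "m2 = turn l2"
    | "m1 = turn l1" "m2 = l2" | "m1 = l1" "m2 = turn l2"
    by blast
  then show ?thesis
  proof cases
    case 1
    then show ?thesis by simp
  next
    case 2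
    then show ?thesis using lower_sum_turn[OF assms(1,2)] by simp
  next
    case 3
    then show ?thesis using half eq by simp
  next
    case 4
    then show ?thesis using half eq other by simp
  qed
qed

lemma card_bloc_below:
  assumes "A \<subseteq> points" "A' \<subseteq> points" "colour A = colour A'"
  shows "card {C \<in> bloc k. C \<subseteq> A} = card {C \<in> bloc k. C \<subseteq> A'}"
proof -
  have below: "card {C \<in> bloc k. C \<subseteq> X} =
      lower_sum (\<lambda>c. of_bool (c = k)) (signature 0 X) (signature 4 X)" if "X \<subseteq> points" for X
  proof -
    have "finite (Pow X)"
      using finite_subset[OF that] by simp
    have "{C \<in> bloc k. C \<subseteq> X} = Pow X \<inter> {C. colour C = k}"
      using that by (auto simp only: mem_bloc)
    then have "card {C \<in> bloc k. C \<subseteq> X} = (\<Sum>C\<in>Pow X. of_bool (colour C = k))"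
      using \<open>finite (Pow X)\<close> by simp
    then show ?thesis
      using sum_Pow_colour[OF that, where h = "\<lambda>c. of_bool (c = k)"] by simp
  qed
  have "lower_sum h (signature 0 A) (signature 4 A) = lower_sum h (signature 0 A') (signature 4 A')"
    for h
    using assms(3) unfolding colour_def
    by (intro lower_sum_cong signature_in_signatures)
  then show ?thesis
    unfolding below[OF assms(1)] below[OF assms(2)] .
qed

lemma mem_blocs:
  assumes "B \<in> blocs" "A \<in> B"
  shows "A \<subseteq> points" "B = bloc (colour A)"
  using assms unfolding blocs_def bloc_def by blast+

lemma partition_on_blocs: "partition_on (Pow points) blocs"
proof (rule partition_onI)
  show "\<Union>blocs = Pow points"
    unfolding blocs_def bloc_def by blast
  show "{} \<notin> blocs"
    unfolding blocs_def bloc_def by blast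
  fix B B' assume "B \<in> blocs" "B' \<in> blocs" "B \<noteq> B'"
  then show "disjnt B B'"
    using mem_blocs(2) unfolding disjnt_iff by metis
qed

fun complement_colour :: "colour \<Rightarrow> colour" where
  "complement_colour (s1, e1, s2, e2, p, q, r) = (4 - s1, e1, 4 - s2, e2, -p, -q, r)"

lemma signature_complement:
  assumes "square q \<subseteq> points" "signature q A = (s, d, x)"
  shows "signature q (points - A) = (4 - s, -d, x)"
proof -
  have flip: "corner (points - A) i = 1 - corner A i" if "i \<in> square q" for i
    using that assms(1) by (auto simp: corner_def)
  have "corner (points - A) q = 1 - corner A q" "corner (points - A) (q + 1) = 1 - corner A (q + 1)"
    "corner (points - A) (q + 2) = 1 - corner A (q + 2)"
    "corner (points - A) (q + 3) = 1 - corner A (q + 3)"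
    by (rule flip, simp add: square_def)+
  then have "signature q (points - A) =
      (4 - fst (signature q A), - fst (snd (signature q A)), snd (snd (signature q A)))"
    unfolding signature_def by (simp only: fst_conv snd_conv prod.inject) (simp add: algebra_simps)
  then show ?thesis
    by (simp only: assms(2) fst_conv snd_conv)
qed

lemma colour_complement: "colour (points - A) = complement_colour (colour A)"
proof -
  obtain s1 d1 x1 where 1: "signature 0 A = (s1, d1, x1)" by (cases "signature 0 A")
  obtain s2 d2 x2 where 2: "signature 4 A = (s2, d2, x2)" by (cases "signature 4 A")
  show ?thesis
    using signature_complement[OF _ 1] signature_complement[OF _ 2]
    by (simp add: colour_def 1 2 points_def)
qed

lemma complement_bloc: "(\<lambda>A. points - A) ` bloc k = bloc (complement_colour k)"
proof -
  have involution: "complement_colour (complement_colour j) = j" for j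
    by (cases j) simp
  show ?thesis
  proof (intro equalityI subsetI)
    fix C assume "C \<in> (\<lambda>A. points - A) ` bloc k"
    then show "C \<in> bloc (complement_colour k)"
      by (auto simp: bloc_def colour_complement)
  next
    fix C assume "C \<in> bloc (complement_colour k)"
    then have "C = points - (points - C)" "points - C \<in> bloc k"
      by (auto simp: bloc_def colour_complement involution)
    then show "C \<in> (\<lambda>A. points - A) ` bloc k"
      by blast
  qed
qed

lemma card_eq_colour:
  assumes "A \<subseteq> points"
  shows "int (card A) = fst (colour A) + fst (snd (snd (colour A)))"
proof -
  have "int (card A) = (\<Sum>i\<in>points. corner A i)"
    using assms by (simp add: corner_def Int_absorb1)
  also have "\<dots> = fst (signature 0 A) + fst (signature 4 A)"
    by (simp add: points_def square_def signature_def)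
  finally show ?thesis
    by (cases "signature 0 A"; cases "signature 4 A") (simp add: colour_def)
qed

lemma strongly_regular_blocs: "strongly_regular_partition points blocs"
  unfolding strongly_regular_partition_def
proof (intro conjI ballI)
  show "partition_on (Pow points) blocs"
    by (rule partition_on_blocs)
next
  fix B A A' assume B: "B \<in> blocs" "A \<in> B" "A' \<in> B"
  then have "colour A' = colour A"
    using mem_blocs(2)[OF B(1,2)] by (simp only: mem_bloc)
  then have "int (card A) = int (card A')"
    using mem_blocs(1) B by (simp only: card_eq_colour)
  then show "card A = card A'"
    by simp
next
  fix B assume "B \<in> blocs"
  then obtain A where "A \<subseteq> points" "B = bloc (colour A)"
    unfolding blocs_def by blast
  then have "(\<lambda>A. points - A) ` B = bloc (colour (points - A))"
    by (simp only: complement_bloc colour_complement)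
  then show "(\<lambda>A. points - A) ` B \<in> blocs"
    unfolding blocs_def by blast
next
  fix B B' A A' assume B: "B \<in> blocs" "B' \<in> blocs" "A \<in> B" "A' \<in> B"
  then have "colour A = colour A'"
    using mem_blocs(2)[OF B(1,3)] by (simp only: mem_bloc)
  moreover obtain k where "B' = bloc k"
    using B(2) unfolding blocs_def by blast
  ultimately show "card {C \<in> B'. C \<subseteq> A} = card {C \<in> B'. C \<subseteq> A'}"
    using card_bloc_below[OF mem_blocs(1)[OF B(1,3)] mem_blocs(1)[OF B(1,4)]] by simp
qed

section \<open>The blocs are not orbits\<close>

lemma orbit_eq_bloc:
  assumes G: "subgroup G (BijGroup points)" and eq: "powerset_orbits points G = blocs"
    and A: "A \<subseteq> points"
  shows "{\<sigma> ` A | \<sigma>. \<sigma> \<in> G} = bloc (colour A)"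
proof -
  have "\<one>\<^bsub>BijGroup points\<^esub> ` A = A"
    using A by (force simp: BijGroup_def)
  then have mem: "A \<in> {\<sigma> ` A | \<sigma>. \<sigma> \<in> G}"
    using subgroup.one_closed[OF G] by fastforce
  have "{\<sigma> ` A | \<sigma>. \<sigma> \<in> G} \<in> blocs"
    using A unfolding eq[symmetric] powerset_orbits_def orbits_def orbit_def by auto
  then show ?thesis
    using mem by (rule mem_blocs(2))
qed

text \<open>The sets \<open>{0, 4}\<close> and \<open>{0, 5}\<close> have the same colour but opposite products of biases. A
  permutation taking one to the other reverses the bias in the second square only, hence has to
  reverse the side directions in the first square only, which changes the product of the side
  signs of \<open>{0, 1}\<close> and \<open>{4, 5}\<close>.\<close>

lemma blocs_not_orbits:
  assumes G: "subgroup G (BijGroup points)"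
  shows "powerset_orbits points G \<noteq> blocs"
proof
  assume eq: "powerset_orbits points G = blocs"
  note colour_simps = colour_def signature_def corner_def
  have points: "points = {0,1,2,3,4,5,6,7}"
    by (auto simp: points_def square_def)
  have "{0,5} \<in> bloc (colour {0,4})"
    by (simp add: bloc_def points colour_simps)
  then have "{0,5} \<in> {\<sigma> ` {0,4} | \<sigma>. \<sigma> \<in> G}"
    using orbit_eq_bloc[OF G eq, of "{0,4}"] by (simp add: points)
  then obtain \<sigma> where \<sigma>: "\<sigma> \<in> G" and img: "\<sigma> ` {0,4} = {0,5}"
    by auto
  have preserve: "\<sigma> ` A \<in> bloc (colour A)" if "A \<subseteq> points" for A
    using orbit_eq_bloc[OF G eq that] \<sigma> by blast
  have pos: "\<sigma> i \<in> points" and col: "colour {\<sigma> i} = colour {i}" if "i \<in> points" for i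
    using preserve[of "{i}"] that by (simp_all add: mem_bloc)
  have col_first: "colour {i} = (1, 1, 0, 0, 0, 0, 0)" if "i \<in> {0,1,2,3}" for i
    using that by (elim insertE emptyE) (simp_all add: colour_simps)
  have col_second: "colour {i} = (0, 0, 1, 1, 0, 0, 0)" if "i \<in> {4,5,6,7}" for i
    using that by (elim insertE emptyE) (simp_all add: colour_simps)
  have first: "\<sigma> i \<in> {0,1,2,3}" if "i \<in> {0,1,2,3}" for i
  proof (rule ccontr)
    have i: "i \<in> points"
      using that unfolding points by blast
    assume "\<sigma> i \<notin> {0,1,2,3}"
    then have "\<sigma> i \<in> {4,5,6,7}"
      using pos[OF i] unfolding points by blast
    then show False
      using col[OF i] col_first[OF that] col_second[of "\<sigma> i"] by simp
  qed
  have second: "\<sigma> i \<in> {4,5,6,7}" if "i \<in> {4,5,6,7}" for i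
  proof (rule ccontr)
    have i: "i \<in> points"
      using that unfolding points by blast
    assume "\<sigma> i \<notin> {4,5,6,7}"
    then have "\<sigma> i \<in> {0,1,2,3}"
      using pos[OF i] unfolding points by blast
    then show False
      using col[OF i] col_second[OF that] col_first[of "\<sigma> i"] by simp
  qed
  obtain a b where a: "\<sigma> 1 = a" and b: "\<sigma> 5 = b"
    by blast
  have "\<sigma> 0 \<in> {0,5}" "\<sigma> 4 \<in> {0,5}"
    using img by blast+
  then have \<sigma>0: "\<sigma> 0 = 0" and \<sigma>4: "\<sigma> 4 = 5"
    using first[of 0] second[of 4] by auto
  note image_simps = mem_bloc image_insert image_empty \<sigma>0 \<sigma>4 a b
  have "a \<in> {0,1,2,3}"
    unfolding a[symmetric] by (rule first) simp
  moreover have "colour {0, a, 5} = colour {0,1,4}"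
    using preserve[of "{0,1,4}"] unfolding image_simps by (simp add: points)
  ultimately have "a = 3"
    by (elim insertE emptyE) (simp_all add: colour_simps)
  have "b \<in> {4,5,6,7}"
    unfolding b[symmetric] by (rule second) simp
  moreover have "colour {0, 5, b} = colour {0,4,5}"
    using preserve[of "{0,4,5}"] unfolding image_simps by (simp add: points)
  ultimately have "b = 4"
    by (elim insertE emptyE) (simp_all add: colour_simps)
  have "colour {0, a, 5, b} = colour {0,1,4,5}"
    using preserve[of "{0,1,4,5}"] unfolding image_simps by (simp add: points)
  then show False
    by (simp add: \<open>a = 3\<close> \<open>b = 4\<close> colour_simps)
qed

theorem mainTheorem5:
  shows "\<exists>(\<Omega> :: nat set) P. finite \<Omega> \<and> strongly_regular_partition \<Omega> P \<and>
           \<not> (\<exists>G. subgroup G (BijGroup \<Omega>) \<and> powerset_orbits \<Omega> G = P)"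
  using finite_points strongly_regular_blocs blocs_not_orbits by blast

end
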